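(* Let $T$ be a finite tree with at least $4$ vertices. Then the strong $3$-colour graph $S_3(T)$ is connected if and only if $T$ contains the path $P_5$ on $5$ vertices or the graph $I$ as a subgraph, where $I$ is the tree with vertex set $\{x_1,\dots,x_6\}$ and edge set $\{x_1x_2,\,x_2x_3,\,x_4x_5,\,x_5x_6,\,x_2x_5\}$.
   Context: A proper $k$-colouring of a graph $G$ is a map $V(G)\to\{1,\dots,k\}$ giving adjacent vertices different colours; it is strong if all $k$ colours appear. The strong $k$-colour graph $S_k(G)$ has the strong $k$-colourings of $G$ as vertices, two being adjacent iff they differ in colour on exactly one vertex of $G$. *)

theory Defs
  imports
    "Graph_Theory.Digraph_Component"
    "Graph_Theory.Digraph_Isomorphism"
    "HOL-Library.FuncSet"
begin

text \<open>
  Finite simple graphs are finite symmetric loop-free relations (locale \<open>pair_graph\<close>), an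
  undirected edge being a pair of opposite arcs. In such a graph every edge \<open>uv\<close> gives the closed
  walk \<open>u, v, u\<close>, which is a directed cycle, so the library predicates \<open>forest\<close> and \<open>tree\<close> are
  unsuitable here: cycles of an undirected graph are the directed cycles of length at least 3.
\<close>

definition undirected_tree :: "'a pair_pre_digraph \<Rightarrow> bool" where
  "undirected_tree G \<longleftrightarrow> pair_graph G \<and> connected (with_proj G) \<and>
     \<not> (\<exists>p. pre_digraph.cycle (with_proj G) p \<and> length p \<ge> 3)"

text \<open>
  Colourings are extensional functions (\<open>undefined\<close> outside the vertex set), so that two
  colourings are equal as soon as they agree on all vertices.
\<close>

definition proper_colourings :: "nat \<Rightarrow> 'a pair_pre_digraph \<Rightarrow> ('a \<Rightarrow> nat) set" where
  "proper_colourings k G =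
     {c \<in> pverts G \<rightarrow>\<^sub>E {1..k}. \<forall>(u, v) \<in> parcs G. c u \<noteq> c v}"

definition strong_colourings :: "nat \<Rightarrow> 'a pair_pre_digraph \<Rightarrow> ('a \<Rightarrow> nat) set" where
  "strong_colourings k G = {c \<in> proper_colourings k G. c ` pverts G = {1..k}}"

definition strong_colour_graph :: "nat \<Rightarrow> 'a pair_pre_digraph \<Rightarrow> ('a \<Rightarrow> nat) pair_pre_digraph" where
  "strong_colour_graph k G =
     \<lparr> pverts = strong_colourings k G,
       parcs = {(c, d). c \<in> strong_colourings k G \<and> d \<in> strong_colourings k G \<and>
                        (\<exists>!v. v \<in> pverts G \<and> c v \<noteq> d v)} \<rparr>"

text \<open>Containment as a (not necessarily induced) subgraph, up to isomorphism.\<close>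

definition contains_subgraph :: "'a pair_pre_digraph \<Rightarrow> 'b pair_pre_digraph \<Rightarrow> bool" where
  "contains_subgraph G H \<longleftrightarrow>
     (\<exists>H'. subgraph H' (with_proj G) \<and> digraph_iso (with_proj H) H')"

definition path_graph :: "nat \<Rightarrow> nat pair_pre_digraph" where
  "path_graph n =
     \<lparr> pverts = {1..n},
       parcs = {(i, j). i \<in> {1..n} \<and> j \<in> {1..n} \<and> (j = Suc i \<or> i = Suc j)} \<rparr>"

definition graph_I :: "nat pair_pre_digraph" where
  "graph_I =
     (let E = {(1, 2), (2, 3), (4, 5), (5, 6), (2, 5)}
      in \<lparr> pverts = {1..6}, parcs = E \<union> E\<inverse> \<rparr>)"

lemma pair_graph_path_graph: "pair_graph (path_graph n)"
proof -
  have "finite (parcs (path_graph n))"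
    by (rule finite_subset[of _ "{1..n} \<times> {1..n}"]) (auto simp: path_graph_def)
  then show ?thesis
    by unfold_locales (auto simp: path_graph_def symmetric_def sym_def)
qed

lemma pair_graph_graph_I: "pair_graph graph_I"
  by unfold_locales (auto simp: graph_I_def symmetric_def sym_def)

lemma pair_graph_strong_colour_graph:
  assumes "finite (pverts G)"
  shows "pair_graph (strong_colour_graph k G)"
proof -
  have "finite (pverts G \<rightarrow>\<^sub>E {1..k})"
    using assms by (intro finite_PiE) auto
  then have fin: "finite (strong_colourings k G)"
    by (rule rev_finite_subset) (auto simp: strong_colourings_def proper_colourings_def)
  have "finite (parcs (strong_colour_graph k G))"
    by (rule finite_subset[of _ "strong_colourings k G \<times> strong_colourings k G"])
      (auto simp: strong_colour_graph_def fin)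
  moreover have "sym (parcs (strong_colour_graph k G))"
    by (auto simp: strong_colour_graph_def sym_def eq_commute)
  ultimately show ?thesis
    by unfold_locales (auto simp: strong_colour_graph_def symmetric_def fin)
qed

end

theory Submission
  imports Defs
begin

text \<open>
  All proper 3-colourings of a tree are connected by single-vertex recolourings (induction on
  leaves), so only the walks through colourings that use two colours have to be repaired. The
  neighbours of a two-coloured \<open>c\<close> are the colourings \<open>c(w := r)\<close>, where \<open>r\<close> is the missing colour, and
  \<open>c(w := r)\<close>, \<open>c(w' := r)\<close> are joined through \<open>c(w := r, w' := r)\<close> whenever \<open>w\<close>, \<open>w'\<close> are nonadjacent
  and do not exhaust a colour class. A path on five vertices or a copy of \<open>I\<close> supplies enough such
  pairs to link all the \<open>c(w := r)\<close>. A tree containing neither has a vertex \<open>x\<close> that is adjacent to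
  all other vertices but at most one, and then the colour of \<open>x\<close> can never change.
\<close>

section \<open>Connectedness and subgraph containment\<close>

text \<open>\<open>connected\<close> means strong connectivity of the symmetric closure. For a
  symmetric graph the closure does not change reachability, and from a vertex of the graph
  reachability is the reflexive transitive closure of the arcs.\<close>

lemma (in pair_wf_digraph) connected_iff_rtrancl:
  assumes "symmetric (with_proj G)"
  shows "connected (with_proj G) \<longleftrightarrow>
    pverts G \<noteq> {} \<and> (\<forall>u\<in>pverts G. \<forall>v\<in>pverts G. (u, v) \<in> (parcs G)\<^sup>*)"
proof -
  have "reachable (with_proj (mk_symmetric (with_proj G))) u v \<longleftrightarrow> (u, v) \<in> (parcs G)\<^sup>*"
    if "u \<in> pverts G" for u v
    using reachable_mk_symmetric_eq[OF assms] reachable_conv'[OF that] by simp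
  then show ?thesis
    by (auto simp: connected_def strongly_connected_def)
qed

text \<open>Replaces isomorphisms, which carry separate maps for arcs, tails and heads, by a single
  injective vertex map; conversely, such a map \<open>f\<close> acts on arcs as
  \<open>map_prod f f\<close>.\<close>

lemma contains_subgraph_iff_embedding:
  assumes "pair_wf_digraph G" "pair_wf_digraph H"
  shows "contains_subgraph G H \<longleftrightarrow>
    (\<exists>f. inj_on f (pverts H) \<and> f ` pverts H \<subseteq> pverts G \<and>
         (\<forall>(u, v)\<in>parcs H. (f u, f v) \<in> parcs G))"
    (is "?L \<longleftrightarrow> ?R")
proof
  assume ?L
  then obtain K hom where K: "subgraph K (with_proj G)"
    and iso: "pre_digraph.digraph_isomorphism (with_proj H) hom"
    and app: "K = app_iso hom (with_proj H)"
    by (auto simp: contains_subgraph_def digraph_iso_def)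
  \<comment> \<open>Compatibility with \<open>with_proj G\<close> forces the arcs of
    \<open>K\<close> to be read as pairs, so the vertex map determines the arc map.\<close>
  have ends: "tail K = fst" "head K = snd"
    using K by (auto simp: subgraph_def compatible_def)
  have "(iso_verts hom u, iso_verts hom v) \<in> parcs G" if "(u, v) \<in> parcs H" for u v
  proof -
    have "iso_arcs hom (u, v) = (iso_verts hom u, iso_verts hom v)"
      using iso that ends unfolding app
      by (auto simp: pre_digraph.digraph_isomorphism_def app_iso_def prod_eq_iff)
    moreover have "iso_arcs hom (u, v) \<in> parcs G"
      using K that unfolding app by (auto simp: subgraph_def)
    ultimately show ?thesis by simp
  qed
  moreover have "inj_on (iso_verts hom) (pverts H)"
    using iso by (simp add: pre_digraph.digraph_isomorphism_def)
  moreover have "iso_verts hom ` pverts H \<subseteq> pverts G"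
    using K unfolding app by (auto simp: subgraph_def)
  ultimately show ?R by blast
next
  assume ?R
  then obtain f where inj: "inj_on f (pverts H)" and sub: "f ` pverts H \<subseteq> pverts G"
    and "\<forall>(u, v)\<in>parcs H. (f u, f v) \<in> parcs G" by blast
  then have arcs: "(f u, f v) \<in> parcs G" if "(u, v) \<in> parcs H" for u v
    using that by blast
  interpret G: pair_wf_digraph G by fact
  interpret H: pair_wf_digraph H by fact
  define hom where "hom = \<lparr>iso_verts = f, iso_arcs = map_prod f f, iso_head = snd, iso_tail = fst\<rparr>"
  have "inj_on (map_prod f f) (parcs H)"
    by (rule inj_on_subset[OF map_prod_inj_on[OF inj inj]]) (auto dest: H.in_arcsD1 H.in_arcsD2)
  then have iso: "H.digraph_isomorphism hom"
    unfolding H.digraph_isomorphism_def hom_def using inj H.wf_digraph by auto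
  have "subgraph (app_iso hom (with_proj H)) (with_proj G)"
  proof (rule subgraphI)
    show "wf_digraph (app_iso hom (with_proj H))"
      using iso by (rule H.wf_digraphI_app_iso)
  qed (use sub arcs G.wf_digraph in \<open>auto simp: hom_def app_iso_def compatible_def\<close>)
  then show ?L
    using iso by (auto simp: contains_subgraph_def digraph_iso_def)
qed

lemma contains_path5_iff:
  assumes "pair_graph G"
  shows "contains_subgraph G (path_graph 5) \<longleftrightarrow>
    (\<exists>x1 x2 x3 x4 x5. distinct [x1, x2, x3, x4, x5] \<and> {x1, x2, x3, x4, x5} \<subseteq> pverts G \<and>
       {(x1, x2), (x2, x3), (x3, x4), (x4, x5)} \<subseteq> parcs G)"
    (is "_ \<longleftrightarrow> ?R")
proof -
  interpret pair_graph G by fact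
  have V: "pverts (path_graph 5) = {1..5}" by (simp add: path_graph_def)
  have wf: "pair_wf_digraph (path_graph 5)"
    using pair_graph_path_graph by (simp add: pair_graph_def pair_digraph_def pair_fin_digraph_def)
  show ?thesis unfolding contains_subgraph_iff_embedding[OF pair_wf_digraph wf] V
  proof
    assume "\<exists>f. inj_on f {1..5} \<and> f ` {1..5} \<subseteq> pverts G \<and>
      (\<forall>(u, v)\<in>parcs (path_graph 5). (f u, f v) \<in> parcs G)"
    then obtain f where inj: "inj_on f {1..5}" and sub: "f ` {1..5} \<subseteq> pverts G"
      and "\<forall>(u, v)\<in>parcs (path_graph 5). (f u, f v) \<in> parcs G" by blast
    then have arcs: "(f u, f v) \<in> parcs G" if "(u, v) \<in> parcs (path_graph 5)" for u v
      using that by blast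
    have "distinct [f 1, f 2, f 3, f 4, f 5]"
      by (simp add: inj_on_eq_iff[OF inj])
    moreover have "{f 1, f 2, f 3, f 4, f 5} \<subseteq> pverts G"
      by (simp add: subsetD[OF sub, OF imageI])
    moreover have "{(f 1, f 2), (f 2, f 3), (f 3, f 4), (f 4, f 5)} \<subseteq> parcs G"
      by (simp add: arcs path_graph_def)
    ultimately show ?R by blast
  next
    assume ?R
    then obtain x1 x2 x3 x4 x5 where dist: "distinct [x1, x2, x3, x4, x5]"
      and sub: "{x1, x2, x3, x4, x5} \<subseteq> pverts G"
      and arcs: "{(x1, x2), (x2, x3), (x3, x4), (x4, x5)} \<subseteq> parcs G"
      by (elim exE conjE) (rule that)
    \<comment> \<open>The vertices of \<open>path_graph\<close> are numbered from 1, list positions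
      from 0.\<close>
    define f where "f i = [x1, x2, x3, x4, x5] ! (i - 1)" for i :: nat
    have "inj_on f {1..5}"
      unfolding f_def by (rule inj_onI) (subst (asm) nth_eq_iff_index_eq[OF dist], auto)
    moreover have "f i \<in> pverts G" if "i \<in> {1..5}" for i
    proof -
      have "f i \<in> set [x1, x2, x3, x4, x5]" unfolding f_def using that by (intro nth_mem) auto
      then show ?thesis using sub by auto
    qed
    moreover have "(f u, f v) \<in> parcs G" if "(u, v) \<in> parcs (path_graph 5)" for u v
    proof -
      have suc: "(f i, f (Suc i)) \<in> parcs G" if "i \<in> {1..4}" for i
      proof -
        have "i = 1 \<or> i = 2 \<or> i = 3 \<or> i = 4" using that by auto
        then show ?thesis using arcs by (elim disjE) (simp_all add: f_def)
      qed
      from that consider "u \<in> {1..4}" "v = Suc u" | "v \<in> {1..4}" "u = Suc v"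
        by (fastforce simp: path_graph_def)
      then show ?thesis using suc pair_sym_arcs by cases (auto simp: symmetric_def elim: symE)
    qed
    ultimately show "\<exists>f. inj_on f {1..5} \<and> f ` {1..5} \<subseteq> pverts G \<and>
      (\<forall>(u, v)\<in>parcs (path_graph 5). (f u, f v) \<in> parcs G)" by blast
  qed
qed

lemma contains_graph_I_iff:
  assumes "pair_graph G"
  shows "contains_subgraph G graph_I \<longleftrightarrow>
    (\<exists>x1 x2 x3 x4 x5 x6. distinct [x1, x2, x3, x4, x5, x6] \<and>
       {x1, x2, x3, x4, x5, x6} \<subseteq> pverts G \<and>
       {(x1, x2), (x2, x3), (x4, x5), (x5, x6), (x2, x5)} \<subseteq> parcs G)"
    (is "_ \<longleftrightarrow> ?R")
proof -
  interpret pair_graph G by fact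
  have V: "pverts graph_I = {1..6}" by (simp add: graph_I_def)
  have wf: "pair_wf_digraph graph_I"
    using pair_graph_graph_I by (simp add: pair_graph_def pair_digraph_def pair_fin_digraph_def)
  show ?thesis unfolding contains_subgraph_iff_embedding[OF pair_wf_digraph wf] V
  proof
    assume "\<exists>f. inj_on f {1..6} \<and> f ` {1..6} \<subseteq> pverts G \<and>
      (\<forall>(u, v)\<in>parcs graph_I. (f u, f v) \<in> parcs G)"
    then obtain f where inj: "inj_on f {1..6}" and sub: "f ` {1..6} \<subseteq> pverts G"
      and "\<forall>(u, v)\<in>parcs graph_I. (f u, f v) \<in> parcs G" by blast
    then have arcs: "(f u, f v) \<in> parcs G" if "(u, v) \<in> parcs graph_I" for u v
      using that by blast
    have "distinct [f 1, f 2, f 3, f 4, f 5, f 6]"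
      by (simp add: inj_on_eq_iff[OF inj])
    moreover have "{f 1, f 2, f 3, f 4, f 5, f 6} \<subseteq> pverts G"
      by (simp add: subsetD[OF sub, OF imageI])
    moreover have "{(f 1, f 2), (f 2, f 3), (f 4, f 5), (f 5, f 6), (f 2, f 5)} \<subseteq> parcs G"
      by (simp add: arcs graph_I_def)
    ultimately show ?R by blast
  next
    assume ?R
    then obtain x1 x2 x3 x4 x5 x6 where dist: "distinct [x1, x2, x3, x4, x5, x6]"
      and sub: "{x1, x2, x3, x4, x5, x6} \<subseteq> pverts G"
      and arcs: "{(x1, x2), (x2, x3), (x4, x5), (x5, x6), (x2, x5)} \<subseteq> parcs G"
      by (elim exE conjE) (rule that)
    define f where "f i = [x1, x2, x3, x4, x5, x6] ! (i - 1)" for i :: nat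
    have "inj_on f {1..6}"
      unfolding f_def by (rule inj_onI) (subst (asm) nth_eq_iff_index_eq[OF dist], auto)
    moreover have "f i \<in> pverts G" if "i \<in> {1..6}" for i
    proof -
      have "f i \<in> set [x1, x2, x3, x4, x5, x6]" unfolding f_def using that by (intro nth_mem) auto
      then show ?thesis using sub by auto
    qed
    moreover have "(f u, f v) \<in> parcs G" if "(u, v) \<in> parcs graph_I" for u v
    proof -
      have half: "(f i, f j) \<in> parcs G" if "(i, j) \<in> {(1, 2), (2, 3), (4, 5), (5, 6), (2, 5)}" for i j
        using that arcs by (elim insertE emptyE) (simp_all add: f_def)
      have "(u, v) \<in> {(1, 2), (2, 3), (4, 5), (5, 6), (2, 5)} \<or>
          (v, u) \<in> {(1, 2), (2, 3), (4, 5), (5, 6), (2, 5)}"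
        using that unfolding graph_I_def Let_def by simp
      then show ?thesis using half pair_sym_arcs unfolding symmetric_def
        by (metis symE with_proj_simps(3))
    qed
    ultimately show "\<exists>f. inj_on f {1..6} \<and> f ` {1..6} \<subseteq> pverts G \<and>
      (\<forall>(u, v)\<in>parcs graph_I. (f u, f v) \<in> parcs G)" by blast
  qed
qed

section \<open>Trees\<close>

locale undirected_tree_graph = pair_graph +
  assumes tree: "undirected_tree G"
begin

abbreviation adj :: "'a \<Rightarrow> 'a \<Rightarrow> bool" where
  "adj u v \<equiv> (u, v) \<in> parcs G"

lemma adj_sym: "adj u v \<Longrightarrow> adj v u"
  using pair_sym_arcs by (auto simp: symmetric_def sym_def)

lemma adj_neq: "adj u v \<Longrightarrow> u \<noteq> v"
  using no_loops' by blast

lemma adj_in_pverts: "adj u v \<Longrightarrow> u \<in> pverts G" "adj u v \<Longrightarrow> v \<in> pverts G"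
  using wellformed' by auto

text \<open>A walk from \<open>r\<close> to \<open>w\<close> has to leave \<open>S\<close>
  somewhere. With a singleton \<open>S\<close> this yields a neighbour, with a larger
  \<open>S\<close> a vertex by which \<open>S\<close> can grow.\<close>

lemma exit_edge:
  assumes "r \<in> S" "S \<subseteq> pverts G" "w \<in> pverts G" "w \<notin> S"
  obtains u v where "u \<in> S" "v \<in> pverts G" "v \<notin> S" "adj u v"
proof -
  have "(r, w) \<in> (parcs G)\<^sup>*"
    using tree connected_iff_rtrancl[OF pair_sym_arcs] assms by (auto simp: undirected_tree_def)
  then have "\<exists>u v. u \<in> S \<and> v \<notin> S \<and> adj u v"
    using assms(1,4) by (induction rule: rtrancl_induct) auto
  then show ?thesis using that adj_in_pverts by blast
qed

text \<open>Paths that stay inside \<open>S\<close>, rather than arbitrary walks, so that a vertex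
  outside \<open>S\<close> with two neighbours in \<open>S\<close> closes a genuine cycle.\<close>

definition path_connected :: "'a set \<Rightarrow> bool" where
  "path_connected S \<longleftrightarrow> (\<forall>u\<in>S. \<forall>v\<in>S. \<exists>p. apath u p v \<and> set (pawalk_verts u p) \<subseteq> S)"

lemma path_connected_singleton: "r \<in> pverts G \<Longrightarrow> path_connected {r}"
  by (auto simp: path_connected_def apath_Nil_iff intro!: exI[of _ "[]"])

text \<open>As \<open>v\<close> lies outside \<open>S\<close>, the edge \<open>uv\<close> can be
  attached to either end of a path in \<open>S\<close> without repeating a vertex.\<close>

lemma path_connected_insert:
  assumes S: "path_connected S" and u: "u \<in> S" "v \<notin> S" "adj u v"
  shows "path_connected (insert v S)"
  unfolding path_connected_def
proof (intro ballI)
  fix a b assume ab: "a \<in> insert v S" "b \<in> insert v S"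
  have vV: "v \<in> pverts G" using u adj_in_pverts by blast
  consider "a = v" "b = v" | "a = v" "b \<in> S" | "a \<in> S" "b = v" | "a \<in> S" "b \<in> S" using ab by blast
  then show "\<exists>p. apath a p b \<and> set (pawalk_verts a p) \<subseteq> insert v S"
  proof cases
    case 1
    then show ?thesis using vV by (intro exI[of _ "[]"]) (auto simp: apath_Nil_iff)
  next
    case 2
    then obtain p where p: "apath u p b" "set (pawalk_verts u p) \<subseteq> S"
      using S u unfolding path_connected_def by blast
    then show ?thesis
      using 2 u by (intro exI[of _ "(v, u) # p"]) (auto simp: apath_Cons_iff adj_sym)
  next
    case 3
    then obtain p where p: "apath a p u" "set (pawalk_verts a p) \<subseteq> S"
      using S u unfolding path_connected_def by blast
    then have "awlast a p = u" by (auto simp: apath_def)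
    then have "apath a (p @ [(u, v)]) v"
      using p u vV by (auto simp: apath_append_iff apath_Cons_iff apath_Nil_iff dest: adj_neq)
    moreover have "set (pawalk_verts a (p @ [(u, v)])) \<subseteq> insert v S"
      using p(2) u by (auto simp: awalk_verts_conv split: if_splits)
    ultimately show ?thesis using 3 by blast
  next
    case 4
    then obtain p where "apath a p b" "set (pawalk_verts a p) \<subseteq> S"
      using S unfolding path_connected_def by blast
    then show ?thesis by blast
  qed
qed

text \<open>Here acyclicity enters: a path in \<open>S\<close> between two different neighbours of
  \<open>v\<close>, closed through \<open>v\<close>, is a cycle of length at least 3.\<close>

lemma path_connected_unique_neighbour:
  assumes S: "path_connected S" and uw: "u \<in> S" "w \<in> S" and v: "v \<notin> S" "adj u v" "adj w v"
  shows "u = w"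
proof (rule ccontr)
  assume "u \<noteq> w"
  obtain p where p: "apath u p w" "set (pawalk_verts u p) \<subseteq> S"
    using S uw unfolding path_connected_def by blast
  have "p \<noteq> []" using p \<open>u \<noteq> w\<close> by (auto simp: apath_Nil_iff)
  have last: "awlast u p = w" using p by (auto simp: apath_def)
  have path: "apath u (p @ [(w, v)]) v"
    using p v last adj_in_pverts(2)[OF v(3)]
    by (auto simp: apath_append_iff apath_Cons_iff apath_Nil_iff dest: adj_neq)
  then have "cycle ((v, u) # p @ [(w, v)])"
    using v adj_sym unfolding cycle_def
    by (intro exI[of _ v]) (auto simp: apath_def awalk_Cons_iff)
  moreover have "length ((v, u) # p @ [(w, v)]) \<ge> 3" using \<open>p \<noteq> []\<close> by (cases p) auto
  ultimately show False using tree by (auto simp: undirected_tree_def)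
qed

text \<open>\<open>{b, a}\<close> is path connected, and \<open>c\<close> would have two neighbours
  in it. The next lemma argues alike with \<open>{c, b, a}\<close> and \<open>d\<close>.\<close>

lemma no_triangle:
  assumes "adj a b" "adj b c" shows "\<not> adj c a"
proof
  assume "adj c a"
  have "path_connected {b, a}"
    by (rule path_connected_insert[of _ a])
      (use assms adj_neq adj_in_pverts path_connected_singleton in blast)+
  then have "b = a"
    by (rule path_connected_unique_neighbour[of _ _ _ c])
      (use assms \<open>adj c a\<close> adj_sym adj_neq in blast)+
  then show False using assms adj_neq by blast
qed

lemma no_square:
  assumes "adj a b" "adj b c" "adj c d" "a \<noteq> c" "b \<noteq> d" shows "\<not> adj d a"
proof
  assume "adj d a"
  have "path_connected {b, a}"
    by (rule path_connected_insert[of _ a])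
      (use assms adj_neq adj_in_pverts path_connected_singleton in blast)+
  then have "path_connected {c, b, a}"
    by (rule path_connected_insert[of _ b]) (use assms adj_sym adj_neq in blast)+
  then have "c = a"
    by (rule path_connected_unique_neighbour[of _ _ _ d])
      (use assms \<open>adj d a\<close> adj_sym adj_neq in blast)+
  then show False using assms by blast
qed

text \<open>Take a maximal nonempty path-connected vertex set with property \<open>P\<close>. If it
  missed a vertex, an edge leaving it would add some \<open>v\<close>, which has only one neighbour
  in the set, so the leaf step would enlarge it.\<close>

lemma leaf_induct:
  assumes single: "\<And>r. r \<in> pverts G \<Longrightarrow> P {r}"
    and leaf: "\<And>S u v. \<lbrakk>S \<subseteq> pverts G; u \<in> S; v \<in> pverts G; v \<notin> S; adj u v;
      \<forall>w\<in>S. adj w v \<longrightarrow> w = u; P S\<rbrakk> \<Longrightarrow> P (insert v S)"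
  shows "P (pverts G)"
proof -
  have nonempty: "pverts G \<noteq> {}"
    using tree by (auto simp: undirected_tree_def connected_def strongly_connected_def)
  then obtain r where r: "r \<in> pverts G" by blast
  let ?F = "{S. S \<subseteq> pverts G \<and> S \<noteq> {} \<and> path_connected S \<and> P S}"
  have "finite ?F" using pair_finite_verts by simp
  moreover have "{r} \<in> ?F" using r single path_connected_singleton by simp
  ultimately obtain S where S: "S \<in> ?F" and max: "\<And>S'. S' \<in> ?F \<Longrightarrow> S \<subseteq> S' \<Longrightarrow> S = S'"
    using finite_has_maximal2 by (metis (no_types, lifting))
  have "S = pverts G"
  proof (rule ccontr)
    assume "S \<noteq> pverts G"
    then obtain s w where "s \<in> S" "w \<in> pverts G" "w \<notin> S" using S by blast
    then obtain u v where uv: "u \<in> S" "v \<in> pverts G" "v \<notin> S" "adj u v"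
      using S exit_edge[of s S w] by blast
    have "path_connected (insert v S)" using uv S path_connected_insert by blast
    moreover have "P (insert v S)"
    proof (rule leaf[OF _ uv])
      show "\<forall>w\<in>S. adj w v \<longrightarrow> w = u"
        using path_connected_unique_neighbour[OF _ _ uv(1,3) _ uv(4)] S by blast
    qed (use S in blast)+
    ultimately have "S = insert v S" using S uv by (intro max) blast+
    then show False using uv by blast
  qed
  then show ?thesis using S by blast
qed

section \<open>Recolouring proper 3-colourings\<close>

text \<open>Relative to \<open>S\<close>, so that leaf induction runs over vertex sets of one fixed
  graph. Values outside \<open>S\<close> are unconstrained; extensionality returns only with the
  colour graph.\<close>

definition proper_on :: "'a set \<Rightarrow> ('a \<Rightarrow> nat) \<Rightarrow> bool" where
  "proper_on S c \<longleftrightarrow> c ` S \<subseteq> {1..3} \<and> (\<forall>u\<in>S. \<forall>v\<in>S. adj u v \<longrightarrow> c u \<noteq> c v)"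

text \<open>The null move \<open>d = c\<close> is permitted, which saves case distinctions when
  moves are lifted or composed.\<close>

definition recolour :: "'a set \<Rightarrow> ('a \<Rightarrow> nat) \<Rightarrow> ('a \<Rightarrow> nat) \<Rightarrow> bool" where
  "recolour S c d \<longleftrightarrow> proper_on S c \<and> proper_on S d \<and> (\<exists>v\<in>S. \<exists>x. d = c(v := x))"

lemma third_colour: "\<exists>r\<in>{1..3::nat}. r \<noteq> p \<and> r \<noteq> q"
proof -
  have "1 \<noteq> p \<and> 1 \<noteq> q \<or> 2 \<noteq> p \<and> 2 \<noteq> q \<or> 3 \<noteq> p \<and> 3 \<noteq> q" by arith
  then show ?thesis by (elim disjE) (auto intro: bexI[of _ 1] bexI[of _ 2] bexI[of _ 3])
qed

text \<open>The leaf \<open>v\<close> meets \<open>S\<close> only in \<open>u\<close>, so its colour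
  is restricted by that of \<open>u\<close> alone.\<close>

lemma proper_on_insert_leaf:
  assumes "u \<in> S" "v \<notin> S" "adj u v" and uniq: "\<forall>w\<in>S. adj w v \<longrightarrow> w = u"
  shows "proper_on (insert v S) (c(v := z)) \<longleftrightarrow> proper_on S c \<and> z \<in> {1..3} \<and> z \<noteq> c u"
proof
  assume L: "proper_on (insert v S) (c(v := z))"
  have "c ` S = (c(v := z)) ` S" using assms(2) by (intro image_cong) auto
  then have "c ` S \<subseteq> {1..3}" using L unfolding proper_on_def by blast
  moreover have "c s \<noteq> c t" if "s \<in> S" "t \<in> S" "adj s t" for s t
  proof -
    have "s \<noteq> v" "t \<noteq> v" using that assms(2) by auto
    moreover have "(c(v := z)) s \<noteq> (c(v := z)) t"
      using L that unfolding proper_on_def by blast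
    ultimately show ?thesis by simp
  qed
  moreover have "(c(v := z)) u \<noteq> (c(v := z)) v"
    using L assms(1,3) unfolding proper_on_def by blast
  then have "z \<noteq> c u" using assms(1,2) by (auto split: if_splits)
  moreover have "(c(v := z)) v \<in> {1..3}" using L unfolding proper_on_def by blast
  ultimately show "proper_on S c \<and> z \<in> {1..3} \<and> z \<noteq> c u"
    unfolding proper_on_def by simp
next
  assume R: "proper_on S c \<and> z \<in> {1..3} \<and> z \<noteq> c u"
  have "(c(v := z)) s \<noteq> (c(v := z)) t"
    if st: "s \<in> insert v S" "t \<in> insert v S" "adj s t" for s t
  proof -
    consider "s = v" "t = v" | "s = v" "t \<in> S" "t \<noteq> v" | "t = v" "s \<in> S" "s \<noteq> v"
      | "s \<in> S" "t \<in> S" "s \<noteq> v" "t \<noteq> v" using st assms(2) by blast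
    then show ?thesis
    proof cases
      case 1
      then show ?thesis using st adj_neq by blast
    next
      case 2
      then have "t = u" using uniq st adj_sym by blast
      then show ?thesis using 2 R by simp
    next
      case 3
      then have "s = u" using uniq st by blast
      then show ?thesis using 3 R by auto
    next
      case 4
      then show ?thesis using R st unfolding proper_on_def by simp
    qed
  qed
  moreover have "(c(v := z)) ` insert v S \<subseteq> {1..3}"
    using R unfolding proper_on_def by auto
  ultimately show "proper_on (insert v S) (c(v := z))" unfolding proper_on_def by blast
qed

lemma recolour_rtranclp_proper_on: "(recolour S)\<^sup>*\<^sup>* c d \<Longrightarrow> proper_on S c \<Longrightarrow> proper_on S d"
  by (induction rule: rtranclp_induct) (auto simp: recolour_def)

text \<open>Every move on \<open>S\<close> is imitated with the leaf present, the leaf stepping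
  aside when it is in the way. Its final colour \<open>z'\<close> is not controlled.\<close>

lemma recolour_lift_leaf:
  assumes leaf: "u \<in> S" "v \<notin> S" "adj u v" "\<forall>w\<in>S. adj w v \<longrightarrow> w = u"
    and steps: "(recolour S)\<^sup>*\<^sup>* c d" and start: "proper_on (insert v S) (c(v := z))"
  shows "\<exists>z'. (recolour (insert v S))\<^sup>*\<^sup>* (c(v := z)) (d(v := z'))"
  using steps
proof (induction rule: rtranclp_induct)
  case base
  then show ?case by blast
next
  case (step d e)
  note proper_iff = proper_on_insert_leaf[OF leaf]
  obtain z' where z': "(recolour (insert v S))\<^sup>*\<^sup>* (c(v := z)) (d(v := z'))"
    using step.IH by blast
  then have "proper_on (insert v S) (d(v := z'))"
    using start recolour_rtranclp_proper_on by blast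
  then have d: "proper_on S d" "z' \<in> {1..3}" "z' \<noteq> d u" using proper_iff by auto
  obtain w x where w: "w \<in> S" "e = d(w := x)" and e: "proper_on S e"
    using step.hyps unfolding recolour_def by blast
  have "w \<noteq> v" using w leaf by blast
  have move: "recolour (insert v S) (d(v := y)) (e(v := y))"
    if "y \<in> {1..3}" "y \<noteq> d u" "y \<noteq> e u" for y
    unfolding recolour_def proper_iff using that d e w \<open>w \<noteq> v\<close>
    by (auto simp: fun_upd_twist)
  show ?case
  proof (cases "z' = e u")
    case False
    then show ?thesis using move[OF d(2,3)] z' by (blast intro: rtranclp.rtrancl_into_rtrancl)
  next
    case True
    \<comment> \<open>The leaf has the colour that \<open>u\<close> is about to take. It first moves
      to a colour different from both the old and the new colour of \<open>u\<close>.\<close>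
    obtain y where y: "y \<in> {1..3}" "y \<noteq> d u" "y \<noteq> e u" using third_colour by blast
    have "recolour (insert v S) (d(v := z')) (d(v := y))"
      unfolding recolour_def proper_iff using y d by (auto intro!: exI[of _ y])
    then show ?thesis using move[OF y] z' by (blast intro: rtranclp.rtrancl_into_rtrancl)
  qed
qed

text \<open>Leaf induction: walk on \<open>S\<close> by hypothesis, lift the walk past the leaf,
  then correct the leaf. Agreement off the vertex set is needed because colourings are total
  functions.\<close>

lemma recolour_connected:
  assumes "proper_on (pverts G) c" "proper_on (pverts G) d" "\<And>x. x \<notin> pverts G \<Longrightarrow> c x = d x"
  shows "(recolour (pverts G))\<^sup>*\<^sup>* c d"
proof -
  have "\<forall>c d. proper_on (pverts G) c \<longrightarrow> proper_on (pverts G) d \<longrightarrow>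
      (\<forall>x. x \<notin> pverts G \<longrightarrow> c x = d x) \<longrightarrow> (recolour (pverts G))\<^sup>*\<^sup>* c d"
  proof (rule leaf_induct, intro allI impI)
    fix r c d assume c: "proper_on {r} c" and d: "proper_on {r} d" and "\<forall>x. x \<notin> {r} \<longrightarrow> c x = d x"
    then have "d = c(r := d r)" by auto
    then have "recolour {r} c d" using c d unfolding recolour_def by blast
    then show "(recolour {r})\<^sup>*\<^sup>* c d" by blast
  next
    fix S u v
    assume "u \<in> S" "v \<notin> S" "adj u v" "\<forall>w\<in>S. adj w v \<longrightarrow> w = u"
    note leaf = this
    note proper_iff = proper_on_insert_leaf[OF leaf]
    assume IH: "\<forall>c d. proper_on S c \<longrightarrow> proper_on S d \<longrightarrow>
      (\<forall>x. x \<notin> S \<longrightarrow> c x = d x) \<longrightarrow> (recolour S)\<^sup>*\<^sup>* c d"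
    show "\<forall>c d. proper_on (insert v S) c \<longrightarrow> proper_on (insert v S) d \<longrightarrow>
      (\<forall>x. x \<notin> insert v S \<longrightarrow> c x = d x) \<longrightarrow> (recolour (insert v S))\<^sup>*\<^sup>* c d"
    proof (intro allI impI)
      fix c d assume c: "proper_on (insert v S) c" and d: "proper_on (insert v S) d"
        and agree: "\<forall>x. x \<notin> insert v S \<longrightarrow> c x = d x"
      have "proper_on (insert v S) (d(v := d v))" using d by simp
      then have dv: "proper_on S d" "d v \<in> {1..3}" "d v \<noteq> d u" unfolding proper_iff by auto
      have "u \<noteq> v" using leaf by blast
      have "proper_on S c" using proper_iff[of c "c v"] c by simp
      \<comment> \<open>The induction hypothesis wants agreement outside \<open>S\<close>, hence
        also at \<open>v\<close>; so the target on \<open>S\<close> is \<open>d\<close> with the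
        value of \<open>c\<close> at \<open>v\<close>.\<close>
      moreover have "proper_on S (d(v := c v))"
      proof -
        have "(d(v := c v)) s = d s" if "s \<in> S" for s using that leaf by auto
        then show ?thesis using dv(1) unfolding proper_on_def by (auto simp del: fun_upd_apply)
      qed
      ultimately have "(recolour S)\<^sup>*\<^sup>* c (d(v := c v))" using IH agree by simp
      moreover have "proper_on (insert v S) (c(v := c v))" using c by simp
      ultimately obtain z where z: "(recolour (insert v S))\<^sup>*\<^sup>* (c(v := c v)) (d(v := c v, v := z))"
        using recolour_lift_leaf[OF leaf] by blast
      then have z: "(recolour (insert v S))\<^sup>*\<^sup>* c (d(v := z))" by simp
      \<comment> \<open>One last move replaces the uncontrolled colour \<open>z\<close> of the leaf
        by \<open>d v\<close>.\<close>
      have "recolour (insert v S) (d(v := z)) d"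
        unfolding recolour_def
      proof (intro conjI)
        show "proper_on (insert v S) (d(v := z))" using z c recolour_rtranclp_proper_on by blast
        show "\<exists>w\<in>insert v S. \<exists>x. d = (d(v := z))(w := x)"
          by (rule bexI[of _ v], rule exI[of _ "d v"]) auto
      qed fact
      then show "(recolour (insert v S))\<^sup>*\<^sup>* c d" using z by simp
    qed
  qed
  then show ?thesis using assms by blast
qed

text \<open>Provides a proper colouring that leaves colour 3 free; recolouring one vertex with 3
  will then give a strong colouring.\<close>

lemma exists_two_colouring: "\<exists>c. proper_on (pverts G) c \<and> c ` pverts G \<subseteq> {1, 2}"
proof (rule leaf_induct)
  show "\<exists>c. proper_on {r} c \<and> c ` {r} \<subseteq> {1, 2}" for r
    by (rule exI[of _ "\<lambda>_. 1"]) (auto simp: proper_on_def dest: adj_neq)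
next
  fix S u v
  assume leaf: "u \<in> S" "v \<notin> S" "adj u v" "\<forall>w\<in>S. adj w v \<longrightarrow> w = u"
  assume "\<exists>c. proper_on S c \<and> c ` S \<subseteq> {1, 2}"
  then obtain c where c: "proper_on S c" "c ` S \<subseteq> {1, 2}" by blast
  have cu: "c u \<in> {1, 2}" using c leaf by blast
  \<comment> \<open>\<open>3 - c u\<close> exchanges the colours 1 and 2.\<close>
  have "proper_on (insert v S) (c(v := 3 - c u))"
    unfolding proper_on_insert_leaf[OF leaf] using c cu by auto
  moreover have "(c(v := 3 - c u)) ` insert v S \<subseteq> {1, 2}"
    using c cu by auto
  ultimately show "\<exists>c. proper_on (insert v S) c \<and> c ` insert v S \<subseteq> {1, 2}" by blast
qed

section \<open>Recolouring strong 3-colourings\<close>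

definition strong :: "('a \<Rightarrow> nat) \<Rightarrow> bool" where
  "strong c \<longleftrightarrow> proper_on (pverts G) c \<and> c ` pverts G = {1..3}"

definition strong_step :: "('a \<Rightarrow> nat) \<Rightarrow> ('a \<Rightarrow> nat) \<Rightarrow> bool" where
  "strong_step c d \<longleftrightarrow> strong c \<and> strong d \<and> (\<exists>v\<in>pverts G. \<exists>x. d = c(v := x))"

lemma strong_step_rtranclp_sym:
  assumes "strong_step\<^sup>*\<^sup>* c d" shows "strong_step\<^sup>*\<^sup>* d c"
proof -
  have sym: "strong_step d c" if cd: "strong_step c d" for c d
  proof -
    obtain v x where v: "v \<in> pverts G" "d = c(v := x)"
      using cd unfolding strong_step_def by blast
    from v(2) have "c = d(v := c v)" by auto
    then show ?thesis using cd v(1) unfolding strong_step_def by blast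
  qed
  show ?thesis using assms
    by (induction rule: rtranclp_induct) (auto intro: sym converse_rtranclp_into_rtranclp)
qed

section \<open>Two-coloured colourings and their strong neighbours\<close>

lemma three_colours:
  assumes "{p, q, r} \<subseteq> {1..3::nat}" "p \<noteq> q" "p \<noteq> r" "q \<noteq> r"
  shows "{p, q, r} = {1..3}"
  using assms by (intro card_subset_eq) auto

text \<open>The ends of an edge already show two colours; a third one at \<open>w\<close> would make
  \<open>c\<close> strong.\<close>

lemma not_strong_two_colours:
  assumes c: "proper_on (pverts G) c" "\<not> strong c" and "adj u v" "w \<in> pverts G"
  shows "c w = c u \<or> c w = c v"
proof (rule ccontr)
  assume neg: "\<not> ?thesis"
  have V: "u \<in> pverts G" "v \<in> pverts G" using assms(3) adj_in_pverts by auto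
  then have "c u \<noteq> c v" "{c u, c v, c w} \<subseteq> {1..3}"
    using assms unfolding proper_on_def by blast+
  then have "{c u, c v, c w} = {1..3}" using neg by (intro three_colours) auto
  then have "{1..3} \<subseteq> c ` pverts G" using V assms(4) by blast
  then show False using c unfolding strong_def proper_on_def by blast
qed

lemma not_strong_common_neighbour:
  assumes "proper_on (pverts G) c" "\<not> strong c" "adj u v" "adj v w"
  shows "c u = c w"
proof -
  have "c v \<noteq> c w" using assms adj_in_pverts unfolding proper_on_def by blast
  then show ?thesis
    using not_strong_two_colours[OF assms(1-3), of w] adj_in_pverts(2)[OF assms(4)] by auto
qed

text \<open>Since \<open>c\<close> does not use \<open>r\<close>, the recoloured vertices could
  conflict only with each other. The vertices \<open>y\<close> and \<open>a\<close> keep the two old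
  colours alive. The choice \<open>w = w'\<close> is permitted and gives the next lemma.\<close>

lemma strong_recolour_two:
  assumes c: "proper_on (pverts G) c" and r: "r \<in> {1..3} - c ` pverts G"
    and w: "w \<in> pverts G" "w' \<in> pverts G" "\<not> adj w w'"
    and y: "y \<in> pverts G - {w, w'}" "a \<in> pverts G - {w, w'}" "c y \<noteq> c a"
  shows "strong (c(w := r, w' := r))"
proof -
  let ?d = "c(w := r, w' := r)"
  have "?d s \<noteq> ?d t" if st: "s \<in> pverts G" "t \<in> pverts G" "adj s t" for s t
  proof -
    have "c s \<noteq> c t" "c s \<noteq> r" "c t \<noteq> r" using c r st unfolding proper_on_def by blast+
    moreover have "\<not> (s \<in> {w, w'} \<and> t \<in> {w, w'})" using st w adj_sym adj_neq by blast
    ultimately show ?thesis by auto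
  qed
  moreover have "?d ` pverts G \<subseteq> {1..3}" using c r unfolding proper_on_def by auto
  ultimately have "proper_on (pverts G) ?d" unfolding proper_on_def by blast
  moreover have "?d ` pverts G = {1..3}"
  proof
    have "{c y, c a, r} = {1..3}"
      using c r y unfolding proper_on_def by (intro three_colours) blast+
    moreover have "?d y = c y" "?d a = c a" "?d w' = r" using y by auto
    then have "c y \<in> ?d ` pverts G" "c a \<in> ?d ` pverts G" "r \<in> ?d ` pverts G"
      using y(1,2) w(2) by (metis DiffD1 imageI)+
    ultimately show "{1..3} \<subseteq> ?d ` pverts G"
      by (metis empty_subsetI insert_subset)
  qed fact
  ultimately show ?thesis unfolding strong_def by blast
qed

lemma strong_recolour_one:
  assumes "proper_on (pverts G) c" "r \<in> {1..3} - c ` pverts G" "w \<in> pverts G"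
    and "y \<in> pverts G - {w}" "a \<in> pverts G - {w}" "c y \<noteq> c a"
  shows "strong (c(w := r))"
  using strong_recolour_two[of c r w w y a] assms adj_neq by auto

lemma strong_swap_recoloured:
  assumes c: "proper_on (pverts G) c" and r: "r \<in> {1..3} - c ` pverts G"
    and w: "w \<in> pverts G" "w' \<in> pverts G" "\<not> adj w w'" "w \<noteq> w'"
    and y: "y \<in> pverts G - {w, w'}" "a \<in> pverts G - {w, w'}" "c y \<noteq> c a"
  shows "strong_step\<^sup>*\<^sup>* (c(w := r)) (c(w' := r))"
proof -
  have s: "strong (c(w := r))" "strong (c(w' := r))"
    by (rule strong_recolour_one[OF c r, where y = y and a = a]; use w y in blast)+
  have s2: "strong (c(w := r, w' := r))"
    by (rule strong_recolour_two[OF c r w(1-3) y])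
  have "strong_step (c(w := r)) (c(w := r, w' := r))"
    using s s2 w unfolding strong_step_def by blast
  moreover have "c(w' := r) = (c(w := r, w' := r))(w := c w)" using w(4) by auto
  then have "strong_step (c(w := r, w' := r)) (c(w' := r))"
    using s s2 w unfolding strong_step_def by blast
  ultimately show ?thesis by auto
qed

text \<open>
  In every two-colouring, the \<open>y\<close>s lie in one class and \<open>a\<close>, \<open>b\<close> in the other. A class containing
  the \<open>y\<close>s is large enough for all its pairs to be usable; the other class may be just \<open>{a, b}\<close>, so
  \<open>a\<close> and \<open>b\<close> each need a nonneighbour among the \<open>y\<close>s.
\<close>

definition spread :: "'a \<Rightarrow> 'a \<Rightarrow> 'a \<Rightarrow> 'a \<Rightarrow> 'a \<Rightarrow> bool" where
  "spread y1 y2 y3 a b \<longleftrightarrow> distinct [y1, y2, y3, a, b] \<and> {y1, y2, y3, a, b} \<subseteq> pverts G \<and>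
     (\<forall>c. proper_on (pverts G) c \<longrightarrow> \<not> strong c \<longrightarrow>
        c y1 = c y2 \<and> c y1 = c y3 \<and> c a = c b \<and> c a \<noteq> c y1) \<and>
     \<not> adj y1 a \<and> (\<not> adj y1 b \<or> \<not> adj y2 b)"

text \<open>\<open>c(y1 := r)\<close> serves as a hub. Vertices of one colour class are nonadjacent,
  so swaps inside a class only need two surviving witnesses; the passage to the other class uses the
  nonadjacent pair \<open>y1\<close>, \<open>a\<close>.\<close>

lemma spread_recoloured_connected:
  assumes sp: "spread y1 y2 y3 a b"
    and c: "proper_on (pverts G) c" "\<not> strong c" and r: "r \<in> {1..3} - c ` pverts G"
    and w: "w \<in> pverts G"
  shows "strong_step\<^sup>*\<^sup>* (c(y1 := r)) (c(w := r))"
proof -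
  have V: "y1 \<in> pverts G" "y2 \<in> pverts G" "y3 \<in> pverts G" "a \<in> pverts G" "b \<in> pverts G"
    using sp unfolding spread_def by auto
  have ne: "y1 \<noteq> y2" "y1 \<noteq> y3" "y2 \<noteq> y3" "a \<noteq> b" "y1 \<noteq> a" "y1 \<noteq> b" "y2 \<noteq> a" "y2 \<noteq> b"
    "y3 \<noteq> a" "y3 \<noteq> b"
    using sp unfolding spread_def by auto
  have col: "c y1 = c y2" "c y1 = c y3" "c a = c b" "c a \<noteq> c y1"
    using sp c unfolding spread_def by blast+
  have nadj: "\<not> adj y1 a" "\<not> adj y1 b \<or> \<not> adj y2 b"
    using sp unfolding spread_def by blast+
  have same: "\<not> adj s t" if "c s = c t" for s t
    using c that adj_in_pverts unfolding proper_on_def by blast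
  note link = strong_swap_recoloured[OF c(1) r]
  have y1a: "strong_step\<^sup>*\<^sup>* (c(y1 := r)) (c(a := r))"
    by (rule link[of _ _ y2 b]) (use V ne col nadj in auto)
  consider "w = y1" | "w \<noteq> y1" "c w = c y1" | "w = a" | "w = b" | "w \<noteq> a" "w \<noteq> b" "c w \<noteq> c y1"
    by blast
  then show ?thesis
  proof cases
    case 1
    then show ?thesis by simp
  next
    case 2
    \<comment> \<open>The witness for the class of \<open>y1\<close> is \<open>y2\<close>, or
      \<open>y3\<close> when \<open>y2\<close> itself is recoloured.\<close>
    show ?thesis
    proof (cases "w = y2")
      case True
      show ?thesis by (rule link[of _ _ y3 a]) (use V ne col 2 w same True in auto)
    next
      case False
      show ?thesis
        by (rule link[of _ _ y2 a]) (use V ne col 2 w same False in auto)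
    qed
  next
    case 3
    then show ?thesis using y1a by simp
  next
    case 4
    show ?thesis
    proof (cases "adj y1 b")
      case False
      show ?thesis unfolding 4 by (rule link[of _ _ y2 a]) (use V ne col False in auto)
    next
      case True
      \<comment> \<open>\<open>y1\<close> and \<open>b\<close> cannot be swapped directly, so the
        route goes through \<open>y2\<close>.\<close>
      then have "\<not> adj y2 b" using nadj by blast
      have "strong_step\<^sup>*\<^sup>* (c(y1 := r)) (c(y2 := r))"
        by (rule link[of _ _ y3 a]) (use V ne col same in auto)
      also have "strong_step\<^sup>*\<^sup>* (c(y2 := r)) (c(b := r))"
        by (rule link[of _ _ y1 a]) (use V ne col \<open>\<not> adj y2 b\<close> in auto)
      finally show ?thesis using 4 by simp
    qed
  next
    case 5
    \<comment> \<open>The edge at \<open>y1\<close> displays both colours of \<open>c\<close>, so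
      \<open>w\<close> and \<open>a\<close>, both coloured differently from \<open>y1\<close>, share
      the colour of \<open>t\<close>.\<close>
    obtain t where t: "adj y1 t" using V(1,2) ne(1) exit_edge[of y1 "{y1}" y2] by blast
    have "c w = c a"
      using not_strong_two_colours[OF c t w] not_strong_two_colours[OF c t V(4)] 5 col by auto
    then have "strong_step\<^sup>*\<^sup>* (c(a := r)) (c(w := r))"
      by (intro link[of _ _ y1 b] same) (use V ne col w 5 in auto)
    then show ?thesis using y1a by simp
  qed
qed

text \<open>
  The second conjunct is the induction invariant when the walk sits at a non-strong colouring: every
  strong way of leaving it is already reachable.
\<close>

lemma strong_detour:
  assumes sp: "spread y1 y2 y3 a b"
    and steps: "(recolour (pverts G))\<^sup>*\<^sup>* c d" and c: "strong c"
  shows "(strong d \<longrightarrow> strong_step\<^sup>*\<^sup>* c d) \<and>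
    (\<not> strong d \<longrightarrow> (\<forall>w\<in>pverts G. \<forall>r\<in>{1..3} - d ` pverts G. strong_step\<^sup>*\<^sup>* c (d(w := r))))"
  using steps
proof (induction rule: rtranclp_induct)
  case base
  then show ?case using c by blast
next
  case (step d e)
  obtain v x where v: "v \<in> pverts G" "e = d(v := x)"
    and d: "proper_on (pverts G) d" and e: "proper_on (pverts G) e"
    using step.hyps unfolding recolour_def by blast
  have xe: "e v = x" "x \<in> {1..3}" using v e unfolding proper_on_def by auto
  have restore: "d = e(v := d v)" using v by auto
  consider "strong d" "strong e" | "strong d" "\<not> strong e" | "\<not> strong d" "strong e"
    | "\<not> strong d" "\<not> strong e" by blast
  then show ?case
  proof cases
    case 1
    then have "strong_step d e" using v unfolding strong_step_def by blast
    then show ?thesis using 1 step.IH by auto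
  next
    case 2
    have "strong_step\<^sup>*\<^sup>* c (e(w := r))" if w: "w \<in> pverts G" and r: "r \<in> {1..3} - e ` pverts G" for w r
    proof -
      \<comment> \<open>The colour \<open>r\<close> is lost in this move, so \<open>v\<close> was
        its last bearer and \<open>d\<close> is itself \<open>e(v := r)\<close>, one of the strong
        neighbours of \<open>e\<close>. The hub links it to all the others.\<close>
      have "r \<in> d ` pverts G" using 2 r unfolding strong_def by blast
      then obtain t where t: "t \<in> pverts G" "d t = r" by blast
      have "t = v"
      proof (rule ccontr)
        assume "t \<noteq> v"
        then have "e t = r" using t v by simp
        then show False using t r by blast
      qed
      then have d_eq: "d = e(v := r)" using restore t by simp
      have "strong_step\<^sup>*\<^sup>* c d" using 2 step.IH by blast
      then have "strong_step\<^sup>*\<^sup>* c (e(v := r))" by (simp only: d_eq)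
      also have "strong_step\<^sup>*\<^sup>* (e(v := r)) (e(y1 := r))"
        using spread_recoloured_connected[OF sp e 2(2) r v(1)] by (rule strong_step_rtranclp_sym)
      also have "strong_step\<^sup>*\<^sup>* (e(y1 := r)) (e(w := r))"
        by (rule spread_recoloured_connected[OF sp e 2(2) r w])
      finally show ?thesis .
    qed
    then show ?thesis using 2 by blast
  next
    case 3
    \<comment> \<open>Becoming strong means that \<open>x\<close> is the missing colour, so
      \<open>e\<close> is one of the exits covered by the invariant.\<close>
    have "x \<notin> d ` pverts G"
    proof
      assume x: "x \<in> d ` pverts G"
      have "e ` pverts G \<subseteq> d ` pverts G" using x v by auto
      then have "{1..3} \<subseteq> d ` pverts G" using 3 unfolding strong_def by blast
      then show False using 3 d unfolding strong_def proper_on_def by blast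
    qed
    then show ?thesis using 3 step.IH v xe by blast
  next
    case 4
    \<comment> \<open>Between two non-strong colourings only the null move exists: the other used
      colour sits on a neighbour of \<open>v\<close>, and the missing colour would make
      \<open>e\<close> strong.\<close>
    have "x = d v"
    proof (rule ccontr)
      assume "x \<noteq> d v"
      have V: "y1 \<in> pverts G" "y2 \<in> pverts G" "a \<in> pverts G" "b \<in> pverts G"
        and ne: "y1 \<noteq> y2" "a \<noteq> b" "y1 \<noteq> a" "y1 \<noteq> b" "y2 \<noteq> a" "y2 \<noteq> b"
        using sp unfolding spread_def by auto
      have col: "d y1 = d y2" "d a = d b" "d a \<noteq> d y1"
        using sp d 4 unfolding spread_def by blast+
      show False
      proof (cases "x \<in> d ` pverts G")
        case True
        obtain s where "s \<in> pverts G" "s \<noteq> v" using V ne by metis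
        then obtain t where t: "adj v t" using v(1) exit_edge[of v "{v}" s] by blast
        have "e v \<noteq> e t" using t e adj_in_pverts unfolding proper_on_def by blast
        then have "x \<noteq> d t" using v adj_neq[OF t] by auto
        then show False
          using True not_strong_two_colours[OF d 4(1) t] \<open>x \<noteq> d v\<close> by auto
      next
        case False
        \<comment> \<open>Representatives of the two colour classes that avoid
          \<open>v\<close>.\<close>
        define y z where "y = (if v = y1 then y2 else y1)" and "z = (if v = a then b else a)"
        have "strong (d(v := x))"
          by (rule strong_recolour_one[OF d, where y = y and a = z])
            (use V ne col False xe v in \<open>auto simp: y_def z_def\<close>)
        then show False using 4 v by blast
      qed
    qed
    then have "e = d" using v by simp
    then show ?thesis using step.IH by blast
  qed
qed

lemma spread_strong_connected:
  assumes "spread y1 y2 y3 a b" "strong c" "strong d" "\<And>x. x \<notin> pverts G \<Longrightarrow> c x = d x"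
  shows "strong_step\<^sup>*\<^sup>* c d"
  using strong_detour[OF assms(1) recolour_connected assms(2), of d] assms(2-4)
  unfolding strong_def by blast

lemma spread_exists_strong:
  assumes sp: "spread y1 y2 y3 a b"
  shows "\<exists>c. strong c"
proof -
  obtain c where c: "proper_on (pverts G) c" "c ` pverts G \<subseteq> {1, 2}"
    using exists_two_colouring by blast
  have "3 \<notin> c ` pverts G" using c by auto
  moreover have "3 \<in> {1..3::nat}" by simp
  ultimately have r: "3 \<in> {1..3} - c ` pverts G" and ns: "\<not> strong c" unfolding strong_def by auto
  have "strong (c(y1 := 3))"
    by (rule strong_recolour_one[OF c(1) r, where y = y2 and a = a])
      (use sp c ns in \<open>auto simp: spread_def\<close>)
  then show ?thesis by blast
qed

section \<open>Spreads in the path on five vertices and in \<open>I\<close>\<close>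

text \<open>The odd vertices form one class. The end \<open>x1\<close> is adjacent to
  \<open>x2\<close> in the role of \<open>b\<close>, so the other end \<open>x5\<close> is the
  second \<open>y\<close>; edges \<open>x1 x4\<close> or \<open>x5 x2\<close> would close a
  square.\<close>

lemma path5_spread:
  assumes "distinct [x1, x2, x3, x4, x5]" and e: "adj x1 x2" "adj x2 x3" "adj x3 x4" "adj x4 x5"
  shows "spread x1 x5 x3 x4 x2"
proof -
  have ne: "x1 \<noteq> x3" "x2 \<noteq> x4" "x3 \<noteq> x5" using assms(1) by auto
  have "\<not> adj x1 x4" using no_square[OF e(1-3) ne(1,2)] adj_sym by blast
  moreover have "\<not> adj x5 x2" using no_square[OF e(2-4) ne(2,3)] by blast
  moreover have "c x1 = c x5 \<and> c x1 = c x3 \<and> c x4 = c x2 \<and> c x4 \<noteq> c x1"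
    if "proper_on (pverts G) c" "\<not> strong c" for c
  proof -
    note com = not_strong_common_neighbour[OF that]
    have "c x1 = c x3" "c x2 = c x4" "c x3 = c x5" using com e by blast+
    moreover have "c x1 \<noteq> c x2" using that e(1) adj_in_pverts unfolding proper_on_def by blast
    ultimately show ?thesis by simp
  qed
  ultimately show ?thesis using assms(1) e adj_in_pverts unfolding spread_def by auto
qed

text \<open>The neighbours of \<open>x2\<close> are the \<open>y\<close>s, and \<open>x4\<close>,
  \<open>x6\<close> at the other centre are \<open>a\<close>, \<open>b\<close>. An edge from
  \<open>x1\<close> to either would close a square through \<open>x2\<close> and
  \<open>x5\<close>.\<close>

lemma graph_I_spread:
  assumes "distinct [x1, x2, x3, x4, x5, x6]"
    and e: "adj x1 x2" "adj x2 x3" "adj x4 x5" "adj x5 x6" "adj x2 x5"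
  shows "spread x1 x3 x5 x4 x6"
proof -
  have ne: "x1 \<noteq> x5" "x2 \<noteq> x4" "x2 \<noteq> x6" using assms(1) by auto
  have "\<not> adj x1 x4" using no_square[OF e(1,5) adj_sym[OF e(3)] ne(1,2)] adj_sym by blast
  moreover have "\<not> adj x1 x6" using no_square[OF e(1,5,4) ne(1,3)] adj_sym by blast
  moreover have "c x1 = c x3 \<and> c x1 = c x5 \<and> c x4 = c x6 \<and> c x4 \<noteq> c x1"
    if "proper_on (pverts G) c" "\<not> strong c" for c
  proof -
    note com = not_strong_common_neighbour[OF that]
    have "c x1 = c x3" "c x1 = c x5" "c x4 = c x6" using com e by blast+
    moreover have "c x4 \<noteq> c x5" using that e(3) adj_in_pverts unfolding proper_on_def by blast
    ultimately show ?thesis by simp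
  qed
  ultimately show ?thesis using assms(1) e adj_in_pverts unfolding spread_def by auto
qed

section \<open>The obstruction: a vertex that keeps its colour\<close>

text \<open>If \<open>x\<close> changed colour, strongness after the move needs another vertex
  \<open>s\<close> with the old colour of \<open>x\<close>, and strongness before it another vertex
  \<open>t\<close> with the new one. Neither is adjacent to \<open>x\<close>, so both equal
  \<open>z\<close>, though their colours differ.\<close>

lemma strong_step_frozen:
  assumes step: "strong_step c d" and x: "x \<in> pverts G"
    and dom: "\<And>v. v \<in> pverts G \<Longrightarrow> v \<noteq> x \<Longrightarrow> \<not> adj x v \<Longrightarrow> v = z"
  shows "c x = d x"
proof (rule ccontr)
  assume ne: "c x \<noteq> d x"
  have c: "proper_on (pverts G) c" "c ` pverts G = {1..3}"
    and d: "proper_on (pverts G) d" "d ` pverts G = {1..3}"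
    using step unfolding strong_step_def strong_def by auto
  have eq: "d v = c v" if "v \<noteq> x" for v
    using step ne that unfolding strong_step_def by auto
  have "c x \<in> d ` pverts G" "d x \<in> c ` pverts G" using x c d by blast+
  then obtain s t where s: "s \<in> pverts G" "d s = c x" and t: "t \<in> pverts G" "c t = d x"
    by (metis imageE)
  have "s \<noteq> x" "t \<noteq> x" using s t ne by auto
  then have "c s = c x" "d t = d x" using s t eq by auto
  then have "\<not> adj x s" "\<not> adj x t" using x s t c d unfolding proper_on_def by metis+
  then have "s = z" "t = z" using dom s t \<open>s \<noteq> x\<close> \<open>t \<noteq> x\<close> by blast+
  then show False using s t \<open>c s = c x\<close> ne by simp
qed

text \<open>If there is a path on four vertices \<open>a b c d\<close>, excluding five-vertex paths
  makes the tree a double star with centres \<open>b\<close>, \<open>c\<close>, and excluding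
  \<open>I\<close> leaves one centre with a single leaf, which is the exception for the other
  centre. Otherwise the tree is a star.\<close>

lemma almost_dominating_vertex:
  assumes card: "card (pverts G) \<ge> 3"
    and no_path: "\<And>x1 x2 x3 x4 x5. distinct [x1, x2, x3, x4, x5] \<Longrightarrow> adj x1 x2 \<Longrightarrow> adj x2 x3 \<Longrightarrow>
      adj x3 x4 \<Longrightarrow> adj x4 x5 \<Longrightarrow> False"
    and no_I: "\<And>x1 x2 x3 x4 x5 x6. distinct [x1, x2, x3, x4, x5, x6] \<Longrightarrow> adj x1 x2 \<Longrightarrow> adj x2 x3 \<Longrightarrow>
      adj x4 x5 \<Longrightarrow> adj x5 x6 \<Longrightarrow> adj x2 x5 \<Longrightarrow> False"
  shows "\<exists>x\<in>pverts G. \<exists>z. \<forall>v\<in>pverts G. v \<noteq> x \<longrightarrow> \<not> adj x v \<longrightarrow> v = z"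
proof (cases "\<exists>a b c d. adj a b \<and> adj b c \<and> adj c d \<and> a \<noteq> c \<and> b \<noteq> d")
  case True
  then obtain a b c d where P: "adj a b" "adj b c" "adj c d" "a \<noteq> c" "b \<noteq> d" by blast
  have "a \<noteq> d" using no_triangle[OF P(1,2)] P(3) by blast
  \<comment> \<open>An edge \<open>m w\<close> leaving the joint neighbourhood of \<open>b\<close>
    and \<open>c\<close> would extend to the path \<open>w m b c d\<close> or
    \<open>w m c b a\<close>.\<close>
  have cover: "adj b v \<or> adj c v" if v: "v \<in> pverts G" for v
  proof (rule ccontr)
    assume neg: "\<not> ?thesis"
    let ?N = "{v \<in> pverts G. adj b v \<or> adj c v}"
    have "c \<in> ?N" using P adj_in_pverts by blast
    then obtain m w where m: "m \<in> ?N" and w: "w \<in> pverts G" "w \<notin> ?N" "adj m w"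
      using exit_edge[of c ?N v] v neg by blast
    have mne: "m \<noteq> b" "m \<noteq> c" using w by blast+
    have wne: "w \<noteq> b" "w \<noteq> c" "w \<noteq> a" "w \<noteq> d" using w P adj_sym adj_in_pverts by blast+
    show False
    proof (cases "adj b m")
      case True
      then have "m \<noteq> d" using no_triangle[OF P(2,3)] adj_sym by blast
      then show False
        using no_path[of w m b c d] True P w mne wne adj_sym adj_neq by auto
    next
      case False
      then have "adj c m" using m by blast
      then have "m \<noteq> a" using False P adj_sym by blast
      then show False
        using no_path[of w m c b a] \<open>adj c m\<close> P w mne wne adj_sym adj_neq by auto
    qed
  qed
  show ?thesis
  proof (cases "\<exists>a'. adj a' b \<and> a' \<noteq> a \<and> a' \<noteq> c")
    case False
    then have "\<forall>v\<in>pverts G. v \<noteq> c \<longrightarrow> \<not> adj c v \<longrightarrow> v = a" using cover adj_sym by blast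
    then show ?thesis using P adj_in_pverts by blast
  next
    case True
    then obtain a' where a': "adj a' b" "a' \<noteq> a" "a' \<noteq> c" by blast
    \<comment> \<open>With two leaves at \<open>b\<close>, a second leaf \<open>d'\<close> at
      \<open>c\<close> would complete a copy of \<open>I\<close>.\<close>
    have "d' = d" if d': "adj c d'" "d' \<noteq> b" for d'
    proof (rule ccontr)
      assume "d' \<noteq> d"
      have "\<not> adj c a" "\<not> adj c a'" using no_triangle P a' by blast+
      then have "a \<noteq> d'" "a' \<noteq> d'" "a' \<noteq> d" using d' P by blast+
      then show False
        using no_I[of a b a' d c d'] P a' d' \<open>d' \<noteq> d\<close> \<open>a \<noteq> d\<close> adj_sym adj_neq by auto
    qed
    then have "\<forall>v\<in>pverts G. v \<noteq> b \<longrightarrow> \<not> adj b v \<longrightarrow> v = d" using cover by blast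
    then show ?thesis using P adj_in_pverts by blast
  qed
next
  case False
  have big: "\<exists>w\<in>pverts G. w \<notin> {r, s}" for r s
  proof (rule ccontr)
    assume "\<not> ?thesis"
    then have "pverts G \<subseteq> {r, s}" by blast
    then have "card (pverts G) \<le> card {r, s}" by (rule card_mono[rotated]) simp
    also have "\<dots> \<le> 2" by (simp add: card_insert_if)
    finally show False using card by simp
  qed
  obtain r where r: "r \<in> pverts G" using big by blast
  obtain s where s: "adj r s" using big[of r r] r exit_edge[of r "{r}"] by blast
  obtain t where t: "t \<noteq> r" "t \<noteq> s" "adj r t \<or> adj s t"
    using big[of r s] s adj_in_pverts exit_edge[of r "{r, s}"] by blast
  \<comment> \<open>A third vertex attached to the edge \<open>rs\<close> makes \<open>r\<close> or
    \<open>s\<close> a vertex of degree at least two, the centre of the star.\<close>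
  have "\<exists>x m m'. adj x m \<and> adj x m' \<and> m \<noteq> m'" using s t adj_sym by blast
  then obtain x m m' where x: "adj x m" "adj x m'" "m \<noteq> m'" by blast
  have "v = x \<or> adj x v" if v: "v \<in> pverts G" for v
  proof (rule ccontr)
    assume neg: "\<not> ?thesis"
    let ?N = "insert x {v \<in> pverts G. adj x v}"
    have "?N \<subseteq> pverts G" using x adj_in_pverts by blast
    then obtain k w where k: "k \<in> ?N" and w: "w \<in> pverts G" "w \<notin> ?N" "adj k w"
      using exit_edge[of x ?N v] v neg by blast
    have "adj x k" "w \<noteq> x" using k w by blast+
    \<comment> \<open>Of the two neighbours of \<open>x\<close> one differs from \<open>k\<close>,
      and \<open>n x k w\<close> is then a forbidden path on four vertices.\<close>
    moreover obtain n where "adj n x" "n \<noteq> k" using x adj_sym by metis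
    ultimately show False using False w(3) by blast
  qed
  then show ?thesis using x adj_in_pverts by blast
qed

section \<open>The strong 3-colour graph\<close>

lemma strong_colourings_3: "strong_colourings 3 G = {c. strong c} \<inter> extensional (pverts G)"
proof -
  have "(\<forall>(u, v)\<in>parcs G. c u \<noteq> c v) \<longleftrightarrow> (\<forall>u\<in>pverts G. \<forall>v\<in>pverts G. adj u v \<longrightarrow> c u \<noteq> c v)"
    for c :: "'a \<Rightarrow> nat"
    using adj_in_pverts by blast
  then show ?thesis
    by (auto simp: strong_colourings_def proper_colourings_def strong_def proper_on_def PiE_def)
qed

lemma strong_colour_graph_step:
  assumes "(c, d) \<in> parcs (strong_colour_graph 3 G)" shows "strong_step c d"
proof -
  have c: "strong c" "c \<in> extensional (pverts G)" and d: "strong d" "d \<in> extensional (pverts G)"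
    and ex: "\<exists>!v. v \<in> pverts G \<and> c v \<noteq> d v"
    using assms by (simp_all add: strong_colour_graph_def strong_colourings_3)
  define v where "v = (THE v. v \<in> pverts G \<and> c v \<noteq> d v)"
  have v: "v \<in> pverts G" using theI'[OF ex] unfolding v_def by (rule conjunct1)
  have v': "w = v" if "w \<in> pverts G" "c w \<noteq> d w" for w
    unfolding v_def by (rule the1_equality[OF ex, symmetric], rule conjI) (fact that)+
  have "d = c(v := d v)"
  proof (rule ext)
    fix w
    show "d w = (c(v := d v)) w"
    proof (cases "w = v")
      case False
      then have "c w = d w"
        using v'[of w] c(2) d(2) by (metis extensional_arb)
      then show ?thesis using False by simp
    qed simp
  qed
  then show ?thesis using c d v unfolding strong_step_def by blast
qed

lemma strong_steps_in_strong_colour_graph: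
  assumes "strong_step\<^sup>*\<^sup>* c d" "c \<in> extensional (pverts G)"
  shows "d \<in> extensional (pverts G) \<and> (c, d) \<in> (parcs (strong_colour_graph 3 G))\<^sup>*"
  using assms(1)
proof (induction rule: rtranclp_induct)
  case base
  then show ?case using assms(2) by blast
next
  case (step d e)
  obtain v x where v: "v \<in> pverts G" "e = d(v := x)" and de: "strong d" "strong e"
    using step.hyps unfolding strong_step_def by blast
  have ext: "d \<in> extensional (pverts G)" "e \<in> extensional (pverts G)"
    using step.IH v by (auto simp: extensional_def)
  show ?case
  proof (cases "x = d v")
    \<comment> \<open>Null moves count as \<open>strong_step\<close> but are not arcs of the colour
      graph.\<close>
    case True
    then show ?thesis using v step.IH by simp
  next
    case False
    then have "\<exists>!w. w \<in> pverts G \<and> d w \<noteq> e w" using v by (intro ex1I[of _ v]) (auto split: if_splits)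
    then have "(d, e) \<in> parcs (strong_colour_graph 3 G)"
      using ext de by (simp add: strong_colour_graph_def strong_colourings_3)
    then show ?thesis using step.IH ext by (blast intro: rtrancl_into_rtrancl)
  qed
qed

lemma connected_strong_colour_graph_iff:
  "connected (with_proj (strong_colour_graph 3 G)) \<longleftrightarrow>
    strong_colourings 3 G \<noteq> {} \<and> (\<forall>c\<in>strong_colourings 3 G. \<forall>d\<in>strong_colourings 3 G.
      (c, d) \<in> (parcs (strong_colour_graph 3 G))\<^sup>*)"
proof -
  interpret S: pair_graph "strong_colour_graph 3 G"
    using pair_finite_verts by (rule pair_graph_strong_colour_graph)
  show ?thesis
    unfolding S.connected_iff_rtrancl[OF S.pair_sym_arcs] by (simp add: strong_colour_graph_def)
qed

lemma spread_imp_connected: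
  assumes sp: "spread y1 y2 y3 a b"
  shows "connected (with_proj (strong_colour_graph 3 G))"
  unfolding connected_strong_colour_graph_iff
proof (intro conjI ballI)
  obtain c where c: "strong c" using spread_exists_strong[OF sp] by blast
  have "strong (restrict c (pverts G))"
    using c unfolding strong_def proper_on_def by auto
  then show "strong_colourings 3 G \<noteq> {}" unfolding strong_colourings_3 by auto
next
  fix c d assume "c \<in> strong_colourings 3 G" "d \<in> strong_colourings 3 G"
  then have "strong c" "strong d" and ext: "c \<in> extensional (pverts G)" "d \<in> extensional (pverts G)"
    unfolding strong_colourings_3 by auto
  then have "strong_step\<^sup>*\<^sup>* c d"
    by (intro spread_strong_connected[OF sp]) (auto simp: extensional_def)
  then show "(c, d) \<in> (parcs (strong_colour_graph 3 G))\<^sup>*"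
    using strong_steps_in_strong_colour_graph ext by blast
qed

text \<open>Permuting the colours of a strong colouring gives another one with a different colour at
  \<open>x\<close>, whereas \<open>x\<close> keeps its colour along every walk. Without any strong
  colouring the graph is empty, hence not connected.\<close>

lemma almost_dominating_imp_not_connected:
  assumes x: "x \<in> pverts G"
    and dom: "\<And>v. v \<in> pverts G \<Longrightarrow> v \<noteq> x \<Longrightarrow> \<not> adj x v \<Longrightarrow> v = z"
  shows "\<not> connected (with_proj (strong_colour_graph 3 G))"
proof
  assume con: "connected (with_proj (strong_colour_graph 3 G))"
  then obtain c where c: "strong c" "c \<in> extensional (pverts G)"
    unfolding connected_strong_colour_graph_iff strong_colourings_3 by blast
  obtain k where k: "k \<in> {1..3}" "k \<noteq> c x" using third_colour by blast
  have cx: "c x \<in> {1..3}" using c x unfolding strong_def by blast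
  \<comment> \<open>The transposition of the colours \<open>c x\<close> and
    \<open>k\<close>.\<close>
  define p where "p = id(c x := k, k := c x)"
  have inj: "p i = p j \<longleftrightarrow> i = j" for i j unfolding p_def using k by auto
  have img: "p ` {1..3} = {1..3}"
  proof (rule endo_inj_surj)
    show "p ` {1..3} \<subseteq> {1..3}" unfolding p_def using k cx by auto
  qed (simp_all add: inj_on_def inj)
  define d where "d = restrict (p \<circ> c) (pverts G)"
  have "d ` pverts G = p ` c ` pverts G" unfolding d_def by auto
  then have "strong d"
    using c(1) img unfolding strong_def proper_on_def d_def by (simp add: inj)
  then have d: "d \<in> strong_colourings 3 G" unfolding strong_colourings_3 d_def by simp
  have "c \<in> strong_colourings 3 G" using c unfolding strong_colourings_3 by simp
  then have "(c, d) \<in> (parcs (strong_colour_graph 3 G))\<^sup>*"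
    using con d unfolding connected_strong_colour_graph_iff by blast
  then have "c x = d x"
  proof (induction rule: rtrancl_induct)
    case (step d e)
    then show ?case using strong_step_frozen[OF strong_colour_graph_step x dom] by metis
  qed simp
  then show False using x k unfolding d_def p_def by auto
qed

end

theorem theorem5p2:
  fixes T :: "'a pair_pre_digraph"
  assumes "undirected_tree T"
    and "card (pverts T) \<ge> 4"
  shows "connected (with_proj (strong_colour_graph 3 T)) \<longleftrightarrow>
    contains_subgraph T (path_graph 5) \<or> contains_subgraph T graph_I"
proof -
  interpret undirected_tree_graph T
    using assms(1) by (simp add: undirected_tree_graph_def undirected_tree_graph_axioms_def
        undirected_tree_def)
  have graph: "pair_graph T" using assms(1) by (simp add: undirected_tree_def)
  show ?thesis
  proof
    assume con: "connected (with_proj (strong_colour_graph 3 T))"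
    show "contains_subgraph T (path_graph 5) \<or> contains_subgraph T graph_I"
    proof (rule ccontr)
      assume neg: "\<not> ?thesis"
      have "\<exists>x\<in>pverts T. \<exists>z. \<forall>v\<in>pverts T. v \<noteq> x \<longrightarrow> \<not> adj x v \<longrightarrow> v = z"
      proof (rule almost_dominating_vertex)
        fix x1 x2 x3 x4 x5
        assume P: "distinct [x1, x2, x3, x4, x5]" "adj x1 x2" "adj x2 x3" "adj x3 x4" "adj x4 x5"
        then have "{x1, x2, x3, x4, x5} \<subseteq> pverts T" using adj_in_pverts by blast
        then have "contains_subgraph T (path_graph 5)"
          unfolding contains_path5_iff[OF graph] using P
          by (intro exI[of _ x1] exI[of _ x2] exI[of _ x3] exI[of _ x4] exI[of _ x5]) simp
        then show False using neg by blast
      next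
        fix x1 x2 x3 x4 x5 x6
        assume P: "distinct [x1, x2, x3, x4, x5, x6]"
          "adj x1 x2" "adj x2 x3" "adj x4 x5" "adj x5 x6" "adj x2 x5"
        then have "{x1, x2, x3, x4, x5, x6} \<subseteq> pverts T" using adj_in_pverts by blast
        then have "contains_subgraph T graph_I"
          unfolding contains_graph_I_iff[OF graph] using P
          by (intro exI[of _ x1] exI[of _ x2] exI[of _ x3] exI[of _ x4] exI[of _ x5] exI[of _ x6]) simp
        then show False using neg by blast
      qed (use assms(2) in simp)
      then obtain x z where "x \<in> pverts T" "\<forall>v\<in>pverts T. v \<noteq> x \<longrightarrow> \<not> adj x v \<longrightarrow> v = z" by blast
      then show False using almost_dominating_imp_not_connected[of x z] con by blast
    qed
  next
    assume "contains_subgraph T (path_graph 5) \<or> contains_subgraph T graph_I"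
    then show "connected (with_proj (strong_colour_graph 3 T))"
      unfolding contains_path5_iff[OF graph] contains_graph_I_iff[OF graph]
    proof (elim disjE exE conjE)
      fix x1 x2 x3 x4 x5
      assume "distinct [x1, x2, x3, x4, x5]" "{(x1, x2), (x2, x3), (x3, x4), (x4, x5)} \<subseteq> parcs T"
      then show ?thesis by (intro spread_imp_connected[OF path5_spread[of x1 x2 x3 x4 x5]]) simp_all
    next
      fix x1 x2 x3 x4 x5 x6
      assume "distinct [x1, x2, x3, x4, x5, x6]"
        "{(x1, x2), (x2, x3), (x4, x5), (x5, x6), (x2, x5)} \<subseteq> parcs T"
      then show ?thesis
        by (intro spread_imp_connected[OF graph_I_spread[of x1 x2 x3 x4 x5 x6]]) simp_all
    qed
  qed
qed

end
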